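(* Let $m>1$ be an integer. For any polynomial $f$ with integer coefficients whose degree is greater than $1$ and for any positive integer $s$, the sequence (indexed by $n=1,2,\ldots$) of random vectors $$\left(\frac{\kappa_n}{m^n},\frac{f(\kappa_n)\bmod m^n}{m^n},\ldots,\frac{f^{(s-1)}(\kappa_n)\bmod m^n}{m^n}\right),$$ where $\kappa_n$ has the discrete uniform distribution on the finite set $\{0,1,\ldots,m^n-1\}$, converges weakly, as $n\to\infty$, to the continuous uniform distribution on $[0,1)^s$.
   Context: For an integer $x$, $x\bmod m^n$ denotes the least nonnegative residue of $x$ modulo $m^n$. $f^{(i)}$ denotes the $i$-th iterate of $f$: $f^{(0)}(x)=x$, $f^{(1)}(x)=f(x)$, $f^{(2)}(x)=f(f(x))$, etc. The discrete uniform distribution on a finite set gives every element equal probability. Weak convergence of $s$-dimensional random vectors $\eta_n$ to $\eta$ means that the cumulative distribution functions of $\eta_n$ converge pointwise to that of $\eta$ at every point of $\mathbb R^s$ at which the cumulative distribution function of $\eta$ is continuous. *)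

theory Defs
  imports "HOL-Probability.Probability" "HOL-Computational_Algebra.Polynomial"
begin

text \<open>
  The dimension \<open>s\<close> is a natural number; \<open>\<real>\<^sup>s\<close> is the set \<open>{..<s} \<rightarrow>\<^sub>E UNIV\<close> of
  extensional functions on \<open>{..<s}\<close>, with the Borel product sigma-algebra and the product topology.
\<close>

definition cdf_vec :: "nat \<Rightarrow> (nat \<Rightarrow> real) measure \<Rightarrow> (nat \<Rightarrow> real) \<Rightarrow> real" where
  "cdf_vec s M x = measure M {y \<in> space M. \<forall>i<s. y i \<le> x i}"

text \<open>
  For \<open>s = 1\<close> this is the notion \<^const>\<open>weak_conv_m\<close> of the library, transported to
  functions on \<open>{..<1}\<close>.
\<close>

definition weak_conv_vec ::
    "nat \<Rightarrow> (nat \<Rightarrow> (nat \<Rightarrow> real) measure) \<Rightarrow> (nat \<Rightarrow> real) measure \<Rightarrow> bool" where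
  "weak_conv_vec s M_seq M \<longleftrightarrow>
     (\<forall>x \<in> {..<s} \<rightarrow>\<^sub>E UNIV.
        topcontinuous_at (product_topology (\<lambda>_. euclideanreal) {..<s}) euclideanreal (cdf_vec s M) x \<longrightarrow>
        (\<lambda>n. cdf_vec s (M_seq n) x) \<longlonglongrightarrow> cdf_vec s M x)"

definition orbit_vec :: "int \<Rightarrow> int poly \<Rightarrow> nat \<Rightarrow> nat \<Rightarrow> int \<Rightarrow> (nat \<Rightarrow> real)" where
  "orbit_vec m f s n k =
     (\<lambda>i\<in>{..<s}. real_of_int ((poly f ^^ i) k mod m ^ n) / real_of_int (m ^ n))"

text \<open>The residue in coordinate \<open>0\<close> has no effect on the values taken by \<open>\<kappa>\<^sub>n\<close>.\<close>

lemma orbit_vec_0: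
  assumes "s > 0" and "k \<in> {0..<m ^ n}"
  shows "orbit_vec m f s n k 0 = real_of_int k / real_of_int (m ^ n)"
  using assms by (simp add: orbit_vec_def)

definition orbit_law :: "int \<Rightarrow> int poly \<Rightarrow> nat \<Rightarrow> nat \<Rightarrow> (nat \<Rightarrow> real) measure" where
  "orbit_law m f s n =
     distr (measure_pmf (pmf_of_set {0..<m ^ n})) (Pi\<^sub>M {..<s} (\<lambda>_. borel)) (orbit_vec m f s n)"

definition uniform_unit_cube :: "nat \<Rightarrow> (nat \<Rightarrow> real) measure" where
  "uniform_unit_cube s =
     uniform_measure (Pi\<^sub>M {..<s} (\<lambda>_. lborel)) ({..<s} \<rightarrow>\<^sub>E {0..<1})"

end

theory Submission
  imports Defs
begin

text \<open>
  The uniform law on the cube has the distribution function that multiplies the side lengths of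
  the truncated box, so the claim is that the points of the orbits are equidistributed, tested on
  boxes. By Weyl's criterion (\<open>weyl_criterion_boxes\<close>) it suffices that the mean of every nontrivial
  character over the orbit points tends to \<open>0\<close>.

  Write \<open>q = m\<^sup>n\<close>. Since characters ignore integers, the mean of the character with integer
  frequencies \<open>h\<^sub>0, \<dots>, h\<^bsub>s-1\<^esub>\<close> is the complete exponential sum of \<open>exp (2 \<pi> i P(k) / q)\<close> divided by \<open>q\<close>,
  where \<open>P = h\<^sub>0 x + h\<^sub>1 f + \<cdots> + h\<^bsub>s-1\<^esub> f\<^bsup>(s-1)\<^esup>\<close>. The iterates of \<open>f\<close> have degrees \<open>1, d, d\<^sup>2, \<dots>\<close>, which are
  different because \<open>d > 1\<close>, so \<open>P\<close> is not constant (\<open>degree_combination_iter_poly\<close>).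

  For a fixed nonconstant \<open>P\<close> the normalized sums tend to \<open>0\<close> as \<open>q\<close> grows through any integers
  (\<open>weyl_mean_poly_tendsto_0\<close>). This is proved by Weyl differencing: the square of the normalized sum is at
  most the average over \<open>h\<close> of the normalized sums of \<open>P (x + h) - P x\<close>, which has smaller degree.
  After differencing down to linear polynomials, a term survives only if \<open>q\<close> divides a
  number that depends on the shifts, and this is rare. The induction is organized around a bound that is
  uniform in \<open>q\<close> and in the leading coefficient (\<open>weyl_mean_uniform_bound\<close>).
\<close>

section \<open>Characters of the circle\<close>

definition echar :: "real \<Rightarrow> complex" where
  "echar t = cis (2 * pi * t)"

lemma echar_0 [simp]: "echar 0 = 1"
  by (simp add: echar_def)

lemma norm_echar [simp]: "norm (echar t) = 1"
  by (simp add: echar_def)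

lemma echar_add: "echar (s + t) = echar s * echar t"
  by (simp add: echar_def cis_mult algebra_simps)

lemma echar_diff: "echar (s - t) = echar s * cnj (echar t)"
  by (simp add: echar_def cis_mult cis_cnj algebra_simps)

lemma echar_sum: "finite I \<Longrightarrow> echar (\<Sum>i\<in>I. t i) = (\<Prod>i\<in>I. echar (t i))"
  by (induction I rule: finite_induct) (auto simp: echar_add)

lemma echar_of_int [simp]: "echar (of_int k) = 1"
  unfolding echar_def by (metis cis_multiple_2pi Ints_of_int)

lemma echar_eq_1_imp_Ints:
  assumes "echar t = 1"
  shows "t \<in> \<int>"
proof -
  have "cos (2 * pi * t) = 1"
    using assms by (simp add: echar_def complex_eq_iff)
  then obtain n :: int where "2 * pi * t = of_int n * (2 * pi)"
    unfolding cos_one_2pi_int by (auto simp: algebra_simps)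
  then have "t = of_int n"
    by simp
  then show ?thesis by simp
qed

text \<open>The phase of an additive character of modulus \<open>q\<close> matters only modulo \<open>q\<close>. This is what
  allows the residues in the orbit to be replaced by the iterates themselves.\<close>
lemma echar_cong_mod:
  assumes "q > 0" and "q dvd a - b"
  shows "echar (of_int a / of_int q) = echar (of_int b / of_int q)"
proof -
  obtain c where "a - b = q * c"
    using assms(2) by blast
  then have "a = b + q * c"
    by simp
  then have "real_of_int a / of_int q = of_int b / of_int q + of_int c"
    using assms(1) by (simp add: field_simps)
  then show ?thesis
    by (simp add: echar_add)
qed

text \<open>Shifting permutes a complete residue system. Both uses below rest on it: evaluating the sum of
  a nontrivial linear phase, and rewriting a double sum over pairs as a sum over differences.\<close>
lemma sum_residues_shift:
  fixes F :: "int \<Rightarrow> 'a::comm_monoid_add"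
  assumes "q > 0" and per: "\<And>x. F (x + q) = F x"
  shows "(\<Sum>x\<in>{0..<q}. F (x + h)) = (\<Sum>x\<in>{0..<q}. F x)"
proof -
  have nat_per: "F (x + int n * q) = F x" for n x
  proof (induction n)
    case (Suc n)
    have "F (x + int (Suc n) * q) = F ((x + int n * q) + q)"
      by (simp add: algebra_simps)
    then show ?case
      using per Suc by metis
  qed simp
  have mod_per: "F (x mod q) = F x" for x
  proof (cases "x div q \<ge> 0")
    case True
    have "F x = F (x mod q + int (nat (x div q)) * q)"
      using True by (simp add: mult.commute)
    then show ?thesis
      using nat_per by metis
  next
    case False
    have "F (x mod q) = F (x + int (nat (- (x div q))) * q)"
      using False by (simp add: minus_div_mult_eq_mod flip: minus_mult_left)
    then show ?thesis
      using nat_per by metis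
  qed
  show ?thesis
    by (rule sum.reindex_bij_witness[where i = "\<lambda>y. (y - h) mod q" and j = "\<lambda>x. (x + h) mod q"])
       (use assms(1) in \<open>auto simp: mod_simps mod_per\<close>)
qed

section \<open>Complete exponential sums\<close>

definition weyl_mean :: "int \<Rightarrow> (int \<Rightarrow> int) \<Rightarrow> complex" where
  "weyl_mean q g = (\<Sum>x\<in>{0..<q}. echar (of_int (g x) / of_int q)) / of_int q"

text \<open>A difference \<open>g (x + h) - g x\<close> is again of this kind, so induction by differencing
  can be carried out for functions instead of polynomials.\<close>
definition periodic_mod :: "int \<Rightarrow> (int \<Rightarrow> int) \<Rightarrow> bool" where
  "periodic_mod q g \<longleftrightarrow> (\<forall>x. q dvd g (x + q) - g x)"

text \<open>\<open>iter_diff k b g\<close> says that the \<open>k\<close>-fold difference of \<open>g\<close> in the directions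
  \<open>h\<^sub>1, \<dots>, h\<^sub>k\<close> is the constant \<open>b h\<^sub>1 \<cdots> h\<^sub>k\<close>. For a polynomial of degree at most \<open>k\<close>
  the number \<open>b\<close> is \<open>k!\<close> times the coefficient of degree \<open>k\<close>. The bound for the exponential
  sum depends on the polynomial only through \<open>k\<close> and \<open>b\<close>.\<close>
fun iter_diff :: "nat \<Rightarrow> int \<Rightarrow> (int \<Rightarrow> int) \<Rightarrow> bool" where
  "iter_diff 0 b g \<longleftrightarrow> (\<forall>x. g x = b)"
| "iter_diff (Suc k) b g \<longleftrightarrow> (\<forall>h. iter_diff k (h * b) (\<lambda>x. g (x + h) - g x))"

lemma iter_diff_add:
  "iter_diff k b g \<Longrightarrow> iter_diff k c g' \<Longrightarrow> iter_diff k (b + c) (\<lambda>x. g x + g' x)"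
proof (induction k arbitrary: b c g g')
  case (Suc k)
  show ?case
    unfolding iter_diff.simps
  proof
    fix h
    have "iter_diff k (h * b + h * c) (\<lambda>x. (g (x + h) - g x) + (g' (x + h) - g' x))"
      using Suc.prems by (intro Suc.IH) auto
    then show "iter_diff k (h * (b + c)) (\<lambda>x. g (x + h) + g' (x + h) - (g x + g' x))"
      by (simp add: algebra_simps)
  qed
qed auto

lemma iter_diff_mult_const:
  "iter_diff k b g \<Longrightarrow> iter_diff k (c * b) (\<lambda>x. c * g x)"
proof (induction k arbitrary: b g)
  case (Suc k)
  show ?case
    unfolding iter_diff.simps
  proof
    fix h
    have "iter_diff k (c * (h * b)) (\<lambda>x. c * (g (x + h) - g x))"
      using Suc.prems by (intro Suc.IH) auto
    then show "iter_diff k (h * (c * b)) (\<lambda>x. c * g (x + h) - c * g x)"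
      by (simp add: algebra_simps)
  qed
qed auto

lemma iter_diff_shift:
  "iter_diff k b g \<Longrightarrow> iter_diff k b (\<lambda>x. g (x + a))"
proof (induction k arbitrary: b g)
  case (Suc k)
  show ?case
    unfolding iter_diff.simps
  proof
    fix h
    have "iter_diff k (h * b) (\<lambda>x. g (x + a + h) - g (x + a))"
      using Suc.prems by (intro Suc.IH[where g = "\<lambda>x. g (x + h) - g x"]) auto
    then show "iter_diff k (h * b) (\<lambda>x. g (x + h + a) - g (x + a))"
      by (simp add: ac_simps)
  qed
qed auto

lemma iter_diff_const: "iter_diff (Suc k) 0 (\<lambda>_. a)"
  by (induction k arbitrary: a) auto

text \<open>Leibniz rule: the difference of \<open>x * g x\<close> is \<open>x\<close> times the difference of \<open>g\<close> plus
  \<open>h * g (x + h)\<close>. By induction the first summand contributes \<open>k\<close> and the second one \<open>1\<close> to the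
  factor \<open>k + 1\<close>, from which the factorial of the next lemma arises.\<close>
lemma iter_diff_mult_arg:
  "iter_diff k b g \<Longrightarrow> iter_diff (Suc k) (int (Suc k) * b) (\<lambda>x. x * g x)"
proof (induction k arbitrary: b g)
  case 0
  then show ?case
    by (simp add: algebra_simps)
next
  case (Suc k)
  show ?case
    unfolding iter_diff.simps(2)[of "Suc k"]
  proof
    fix h
    have d: "iter_diff k (h * b) (\<lambda>x. g (x + h) - g x)"
      using Suc.prems by simp
    have "iter_diff (Suc k) (int (Suc k) * (h * b) + h * b)
            (\<lambda>x. x * (g (x + h) - g x) + h * g (x + h))"
      by (intro iter_diff_add Suc.IH[OF d] iter_diff_mult_const iter_diff_shift Suc.prems)
    moreover have "int (Suc k) * (h * b) + h * b = h * (int (Suc (Suc k)) * b)"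
      by (simp add: algebra_simps)
    moreover have "(\<lambda>x. x * (g (x + h) - g x) + h * g (x + h)) = (\<lambda>x. (x + h) * g (x + h) - x * g x)"
      by (simp add: algebra_simps)
    ultimately show "iter_diff (Suc k) (h * (int (Suc (Suc k)) * b)) (\<lambda>x. (x + h) * g (x + h) - x * g x)"
      by simp
  qed
qed

lemma iter_diff_poly:
  "degree p \<le> n \<Longrightarrow> iter_diff n (fact n * coeff p n) (poly p)"
proof (induction p arbitrary: n)
  case 0
  then show ?case
    using iter_diff_const[of _ 0] by (cases n) auto
next
  case (pCons a p)
  show ?case
  proof (cases n)
    case 0
    then have "p = 0"
      using pCons.prems by (auto split: if_splits)
    then show ?thesis
      using 0 by simp
  next
    case (Suc k)
    have "degree p \<le> k"
      using pCons.prems Suc by (auto split: if_splits)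
    from iter_diff_add[OF iter_diff_const[of k a] iter_diff_mult_arg[OF pCons.IH[OF this]]]
    show ?thesis
      by (simp add: Suc algebra_simps del: iter_diff.simps)
  qed
qed

lemma periodic_mod_poly: "periodic_mod q (poly p)"
  unfolding periodic_mod_def
proof
  fix x
  show "q dvd poly p (x + q) - poly p x"
  proof (induction p)
    case (pCons a p)
    have "poly (pCons a p) (x + q) - poly (pCons a p) x
            = x * (poly p (x + q) - poly p x) + q * poly p (x + q)"
      by (simp add: algebra_simps)
    then show ?case
      using pCons.IH by simp
  qed simp
qed

lemma periodic_mod_echar:
  assumes "q > 0" and "periodic_mod q g"
  shows "echar (of_int (g (x + q)) / of_int q) = echar (of_int (g x) / of_int q)"
  using assms by (intro echar_cong_mod) (auto simp: periodic_mod_def)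

lemma periodic_mod_difference:
  assumes "periodic_mod q g"
  shows "periodic_mod q (\<lambda>x. g (x + h) - g x)"
  unfolding periodic_mod_def
proof
  fix x
  have "q dvd g ((x + h) + q) - g (x + h)" "q dvd g (x + q) - g x"
    using assms unfolding periodic_mod_def by blast+
  then have "q dvd (g ((x + h) + q) - g (x + h)) - (g (x + q) - g x)"
    by (rule dvd_diff)
  then show "q dvd g (x + q + h) - g (x + q) - (g (x + h) - g x)"
    by (simp add: algebra_simps)
qed

lemma norm_weyl_mean_le_1:
  assumes "q > 0"
  shows "norm (weyl_mean q g) \<le> 1"
proof -
  have "norm (\<Sum>x\<in>{0..<q}. echar (of_int (g x) / of_int q)) \<le> (\<Sum>x\<in>{0..<q}. 1)"
    by (rule order.trans[OF norm_sum]) simp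
  then show ?thesis
    using assms by (simp add: weyl_mean_def norm_divide)
qed

text \<open>Shifting the variable by \<open>1\<close> multiplies the sum by a number different from \<open>1\<close>
  and also leaves the sum unchanged, so the sum vanishes.\<close>
lemma weyl_mean_linear:
  assumes q: "q > 0" and per: "periodic_mod q g" and lin: "iter_diff 1 b g" and b: "\<not> q dvd b"
  shows "weyl_mean q g = 0"
proof -
  define S where "S = (\<Sum>x\<in>{0..<q}. echar (of_int (g x) / of_int q))"
  have step: "g (x + 1) = g x + b" for x
  proof -
    have "g (x + 1) - g x = 1 * b"
      using lin[unfolded One_nat_def iter_diff.simps] by blast
    then show ?thesis by simp
  qed
  have "S = (\<Sum>x\<in>{0..<q}. echar (of_int (g (x + 1)) / of_int q))"
    unfolding S_def
    by (rule sum_residues_shift[symmetric, OF q]) (rule periodic_mod_echar[OF q per])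
  also have "\<dots> = echar (of_int b / of_int q) * S"
    unfolding S_def by (simp add: step add_divide_distrib echar_add sum_distrib_left mult.commute)
  finally have *: "S = echar (of_int b / of_int q) * S" .
  have "S = 0"
  proof (rule ccontr)
    assume "S \<noteq> 0"
    with * have "echar (of_int b / of_int q) = 1"
      by simp
    then have "real_of_int b / of_int q \<in> \<int>"
      by (rule echar_eq_1_imp_Ints)
    then obtain c where "real_of_int b / of_int q = of_int c"
      by (auto elim: Ints_cases)
    then have "real_of_int b = of_int (q * c)"
      using q by (simp add: field_simps)
    then show False
      using b by (metis dvd_triv_left of_int_eq_iff)
  qed
  then show ?thesis
    by (simp add: weyl_mean_def S_def)
qed

text \<open>The squared modulus of the sum is a sum over pairs \<open>(x, y)\<close>. On a complete residue system
  the pairs can be written as \<open>(x, x + h)\<close> with no boundary terms, and each \<open>h\<close> gives the sum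
  for a function of one degree less.\<close>
lemma weyl_differencing:
  assumes q: "q > 0" and per: "periodic_mod q g"
  shows "(norm (weyl_mean q g))\<^sup>2
           \<le> (\<Sum>h\<in>{0..<q}. norm (weyl_mean q (\<lambda>x. g (x + h) - g x))) / of_int q"
proof -
  define E where "E x = echar (of_int (g x) / of_int q)" for x
  define S where "S = (\<Sum>x\<in>{0..<q}. E x)"
  have "of_real ((norm S)\<^sup>2) = S * cnj S"
    by (rule complex_norm_square)
  also have "\<dots> = (\<Sum>x\<in>{0..<q}. S * cnj (E x))"
    by (subst S_def(1)) (simp add: S_def sum_distrib_left)
  also have "\<dots> = (\<Sum>x\<in>{0..<q}. (\<Sum>h\<in>{0..<q}. E (h + x)) * cnj (E x))"
    unfolding S_def E_def
    by (subst sum_residues_shift[OF q, of "\<lambda>x. echar (of_int (g x) / of_int q)"])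
       (auto simp: periodic_mod_echar[OF q per])
  also have "\<dots> = (\<Sum>h\<in>{0..<q}. \<Sum>x\<in>{0..<q}. E (x + h) * cnj (E x))"
    unfolding sum_distrib_right by (subst sum.swap) (simp add: add.commute)
  also have "\<dots> = (\<Sum>h\<in>{0..<q}. of_int q * weyl_mean q (\<lambda>x. g (x + h) - g x))"
    using q by (simp add: weyl_mean_def E_def diff_divide_distrib echar_diff)
  finally have "(norm S)\<^sup>2 = norm (\<Sum>h\<in>{0..<q}. of_int q * weyl_mean q (\<lambda>x. g (x + h) - g x))"
    by (metis norm_of_real abs_of_nonneg zero_le_power2)
  also have "\<dots> \<le> (\<Sum>h\<in>{0..<q}. of_int q * norm (weyl_mean q (\<lambda>x. g (x + h) - g x)))"
    by (rule order.trans[OF norm_sum]) (use q in \<open>simp add: norm_mult\<close>)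
  also have "\<dots> = of_int q * (\<Sum>h\<in>{0..<q}. norm (weyl_mean q (\<lambda>x. g (x + h) - g x)))"
    by (simp add: sum_distrib_left)
  finally have "(norm S)\<^sup>2 / (of_int q)\<^sup>2
      \<le> of_int q * (\<Sum>h\<in>{0..<q}. norm (weyl_mean q (\<lambda>x. g (x + h) - g x))) / (of_int q)\<^sup>2"
    by (rule divide_right_mono) simp
  then show ?thesis
    using q by (simp add: weyl_mean_def S_def E_def norm_divide power_divide power2_eq_square)
qed

text \<open>The exceptional shifts \<open>h\<close> are spaced by at least \<open>G\<close>: two of them at a smaller distance
  would give \<open>q dvd j * b\<close> for \<open>j = t * (h' - h) < G * T\<close>. Hence the blocks of length \<open>G\<close> contain
  at most one each. The additive error of one block is absorbed because \<open>q\<close> itself is at least \<open>G\<close>,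
  again by the hypothesis, with \<open>j = q\<close>.\<close>
lemma card_multipliers_le:
  fixes q b t G T :: int
  assumes q: "q > 0" and G: "G > 0" and t: "1 \<le> t" "t < T"
    and nd: "\<And>j. 1 \<le> j \<Longrightarrow> j < G * T \<Longrightarrow> \<not> q dvd j * b"
  shows "real (card {h\<in>{0..<q}. q dvd t * (h * b)}) \<le> 2 * of_int q / of_int G"
proof -
  let ?B = "{h\<in>{0..<q}. q dvd t * (h * b)}"
  have no: False if "h \<in> ?B" "h' \<in> ?B" "h < h'" "h div G = h' div G" for h h'
  proof -
    have "h' - h < G"
    proof -
      have "h' - h = h' mod G - h mod G"
        using that(4) by (metis add_diff_cancel_left mult_div_mod_eq)
      then show ?thesis
        using pos_mod_bound[OF G, of h'] pos_mod_sign[OF G, of h] by linarith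
    qed
    then have "t * (h' - h) < G * T"
      using t that(3) mult_strict_mono[of t T "h' - h" G] by (simp add: mult.commute)
    moreover have "1 \<le> t * (h' - h)"
      using t that(3) by (simp add: int_one_le_iff_zero_less)
    moreover have "q dvd t * (h' - h) * b"
    proof -
      have "q dvd t * (h' * b) - t * (h * b)"
        using that(1,2) by (intro dvd_diff) auto
      then show ?thesis by (simp add: algebra_simps)
    qed
    ultimately show False
      using nd by blast
  qed
  have "inj_on (\<lambda>h. h div G) ?B"
  proof (rule inj_onI)
    fix h h' assume "h \<in> ?B" "h' \<in> ?B" "h div G = h' div G"
    then show "h = h'"
      using no[of h h'] no[of h' h] by (metis linorder_neqE)
  qed
  moreover have "(\<lambda>h. h div G) ` ?B \<subseteq> {0..q div G}"
    using G by (auto simp: pos_imp_zdiv_nonneg_iff intro!: zdiv_mono1)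
  ultimately have "card ?B \<le> card {0..q div G}"
    by (intro card_inj_on_le) auto
  then have "real (card ?B) \<le> real (nat (q div G + 1))"
    by simp
  also have "\<dots> = of_int (q div G) + 1"
    using q G by (simp add: pos_imp_zdiv_nonneg_iff)
  also have "of_int (q div G) \<le> real_of_int q / of_int G"
    by (metis floor_divide_of_int_eq of_int_floor_le)
  also have "1 \<le> real_of_int q / of_int G"
  proof -
    have "\<not> q < G * T"
      using nd[of q] q by auto
    moreover have "G \<le> G * T"
      using G t by simp
    ultimately have "G \<le> q"
      by linarith
    then show ?thesis
      using G by simp
  qed
  finally show ?thesis
    by simp
qed

text \<open>Weyl's inequality without a rate. The bound \<open>T\<close> depends only on the degree and on \<open>\<epsilon>\<close>; this
  uniformity in \<open>b\<close> and \<open>q\<close> is needed for the induction, which applies the bound to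
  all differences of \<open>g\<close> at once, with \<open>h * b\<close> in place of \<open>b\<close>. The assumption that \<open>q\<close> divides
  no small multiple of \<open>b\<close> says that \<open>b / q\<close> has a large denominator in lowest terms; with a
  smaller bound on the multiples it is inherited by \<open>h * b\<close> for all but a small proportion of the \<open>h\<close>.\<close>
lemma weyl_mean_uniform_bound:
  assumes "k \<ge> 1" and "\<epsilon> > 0"
  shows "\<exists>T. \<forall>q b g. q > 0 \<longrightarrow> periodic_mod q g \<longrightarrow> iter_diff k b g \<longrightarrow>
           (\<forall>t. 1 \<le> t \<longrightarrow> t < T \<longrightarrow> \<not> q dvd t * b) \<longrightarrow> norm (weyl_mean q g) \<le> \<epsilon>"
  using assms
proof (induction k arbitrary: \<epsilon> rule: nat_induct_at_least)
  case base
  show ?case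
  proof (rule exI[of _ 2], intro allI impI)
    fix q b g
    assume "q > 0" "periodic_mod q g" "iter_diff 1 b g" "\<forall>t. 1 \<le> t \<longrightarrow> t < 2 \<longrightarrow> \<not> q dvd t * b"
    then show "norm (weyl_mean q g) \<le> \<epsilon>"
      using weyl_mean_linear[of q g b] \<open>\<epsilon> > 0\<close> by (auto dest: spec[of _ 1])
  qed
next
  case (Suc k)
  have "\<epsilon>\<^sup>2 / 2 > 0"
    using Suc.prems by simp
  from Suc.IH[OF this] obtain T0 where
    T0: "\<And>q b g. q > 0 \<Longrightarrow> periodic_mod q g \<Longrightarrow> iter_diff k b g \<Longrightarrow>
           (\<And>t. 1 \<le> t \<Longrightarrow> t < T0 \<Longrightarrow> \<not> q dvd t * b) \<Longrightarrow> norm (weyl_mean q g) \<le> \<epsilon>\<^sup>2 / 2"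
    by blast
  define T where "T = max T0 1"
  have T: "T \<ge> 1"
    by (simp add: T_def)
  \<comment> \<open>The exceptional \<open>h\<close> will have density at most \<open>2 * T / G\<close>, which this choice makes at most \<open>\<epsilon>\<^sup>2 / 2\<close>.\<close>
  define G where "G = \<lceil>4 * of_int T / \<epsilon>\<^sup>2\<rceil>"
  have G_ge: "4 * of_int T / \<epsilon>\<^sup>2 \<le> real_of_int G"
    by (simp add: G_def)
  have "0 < 4 * of_int T / \<epsilon>\<^sup>2"
    using T Suc.prems by simp
  then have G: "G > 0"
    using G_ge by linarith
  show ?case
  proof (rule exI[of _ "G * T"], intro allI impI)
    fix q b g
    assume q: "q > 0" and per: "periodic_mod q g" and g: "iter_diff (Suc k) b g"
      and nd: "\<forall>t. 1 \<le> t \<longrightarrow> t < G * T \<longrightarrow> \<not> q dvd t * b"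
    define \<mu> where "\<mu> h = norm (weyl_mean q (\<lambda>x. g (x + h) - g x))" for h
    define B where "B = (\<Union>t\<in>{1..<T}. {h\<in>{0..<q}. q dvd t * (h * b)})"
    have good: "\<mu> h \<le> \<epsilon>\<^sup>2 / 2" if "h \<in> {0..<q} - B" for h
      unfolding \<mu>_def
    proof (rule T0[OF q periodic_mod_difference[OF per]])
      show "iter_diff k (h * b) (\<lambda>x. g (x + h) - g x)"
        using g by simp
      show "\<not> q dvd t * (h * b)" if "1 \<le> t" "t < T0" for t
        using \<open>h \<in> {0..<q} - B\<close> that by (force simp: B_def T_def)
    qed
    have "real (card B) \<le> real (\<Sum>t\<in>{1..<T}. card {h\<in>{0..<q}. q dvd t * (h * b)})"
      unfolding B_def of_nat_le_iff by (rule card_UN_le) simp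
    also have "\<dots> \<le> (\<Sum>t\<in>{1..<T}. 2 * of_int q / of_int G)"
      unfolding of_nat_sum using nd q G by (intro sum_mono card_multipliers_le[where T = T]) auto
    also have "\<dots> \<le> of_int T * (2 * of_int q / of_int G)"
      unfolding sum_constant using T q G by (intro mult_right_mono) auto
    finally have cardB: "real (card B) \<le> of_int T * (2 * of_int q / of_int G)" .
    have "(\<Sum>h\<in>{0..<q}. \<mu> h) = (\<Sum>h\<in>{0..<q} - B. \<mu> h) + (\<Sum>h\<in>B. \<mu> h)"
      by (rule sum.subset_diff) (auto simp: B_def)
    also have "(\<Sum>h\<in>{0..<q} - B. \<mu> h) \<le> (\<Sum>h\<in>{0..<q} - B. \<epsilon>\<^sup>2 / 2)"
      by (rule sum_mono) (rule good)
    also have "\<dots> \<le> (\<Sum>h\<in>{0..<q}. \<epsilon>\<^sup>2 / 2)"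
      by (rule sum_mono2) auto
    also have "(\<Sum>h\<in>B. \<mu> h) \<le> (\<Sum>h\<in>B. 1)"
      unfolding \<mu>_def by (rule sum_mono) (rule norm_weyl_mean_le_1[OF q])
    finally have sum_le: "(\<Sum>h\<in>{0..<q}. \<mu> h) \<le> of_int q * (\<epsilon>\<^sup>2 / 2) + real (card B)"
      using q by simp
    have "(norm (weyl_mean q g))\<^sup>2 \<le> (\<Sum>h\<in>{0..<q}. \<mu> h) / of_int q"
      unfolding \<mu>_def by (rule weyl_differencing[OF q per])
    also have "\<dots> \<le> (of_int q * (\<epsilon>\<^sup>2 / 2) + of_int T * (2 * of_int q / of_int G)) / of_int q"
      using sum_le cardB q by (intro divide_right_mono) auto
    also have "\<dots> = \<epsilon>\<^sup>2 / 2 + 2 * of_int T / of_int G"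
      using q by (simp add: add_divide_distrib)
    also have "2 * of_int T / of_int G \<le> \<epsilon>\<^sup>2 / 2"
      using G_ge G Suc.prems by (simp add: field_simps)
    finally have "(norm (weyl_mean q g))\<^sup>2 \<le> \<epsilon>\<^sup>2"
      by (simp only: field_sum_of_halves)
    then show "norm (weyl_mean q g) \<le> \<epsilon>"
      using Suc.prems by (auto dest: power2_le_imp_le)
  qed
qed

text \<open>For a fixed polynomial, \<open>q dvd t * b\<close> with \<open>1 \<le> t < T\<close> forces \<open>q < T * \<bar>b\<bar>\<close>, which fails
  for large \<open>q\<close>.\<close>
theorem weyl_mean_poly_tendsto_0:
  fixes p :: "int poly" and q :: "nat \<Rightarrow> int"
  assumes deg: "degree p > 0" and q: "filterlim q at_top sequentially"
  shows "(\<lambda>n. weyl_mean (q n) (poly p)) \<longlonglongrightarrow> 0"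
proof (rule LIMSEQ_I)
  fix \<epsilon> :: real
  assume "\<epsilon> > 0"
  define b where "b = fact (degree p) * lead_coeff p"
  have "b \<noteq> 0"
    using deg by (auto simp: b_def)
  have "1 \<le> degree p" "\<epsilon> / 2 > 0"
    using deg \<open>\<epsilon> > 0\<close> by auto
  from weyl_mean_uniform_bound[OF this]
  obtain T where T: "\<And>q g. q > 0 \<Longrightarrow> periodic_mod q g \<Longrightarrow> iter_diff (degree p) b g \<Longrightarrow>
      (\<And>t. 1 \<le> t \<Longrightarrow> t < T \<Longrightarrow> \<not> q dvd t * b) \<Longrightarrow> norm (weyl_mean q g) \<le> \<epsilon> / 2"
    by blast
  have "eventually (\<lambda>n. q n \<ge> max 1 (T * \<bar>b\<bar>)) sequentially"
    using q unfolding filterlim_at_top by blast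
  then obtain N where N: "\<And>n. n \<ge> N \<Longrightarrow> q n \<ge> max 1 (T * \<bar>b\<bar>)"
    by (auto simp: eventually_sequentially)
  show "\<exists>N. \<forall>n\<ge>N. norm (weyl_mean (q n) (poly p) - 0) < \<epsilon>"
  proof (rule exI[of _ N], intro allI impI)
    fix n assume "n \<ge> N"
    from N[OF this] have qn: "q n > 0" "q n \<ge> T * \<bar>b\<bar>"
      by auto
    have "\<not> q n dvd t * b" if "1 \<le> t" "t < T" for t
    proof
      assume "q n dvd t * b"
      then have "\<bar>q n\<bar> \<le> \<bar>t * b\<bar>"
        using that \<open>b \<noteq> 0\<close> by (intro dvd_imp_le_int) auto
      also have "\<dots> < T * \<bar>b\<bar>"
        using that \<open>b \<noteq> 0\<close> by (simp add: abs_mult)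
      finally show False
        using qn by simp
    qed
    then have "norm (weyl_mean (q n) (poly p)) \<le> \<epsilon> / 2"
      using iter_diff_poly[of p "degree p"]
      by (intro T qn periodic_mod_poly) (auto simp: b_def)
    then show "norm (weyl_mean (q n) (poly p) - 0) < \<epsilon>"
      using \<open>\<epsilon> > 0\<close> by simp
  qed
qed

section \<open>Iterates of a polynomial\<close>

definition iter_poly :: "int poly \<Rightarrow> nat \<Rightarrow> int poly" where
  "iter_poly f i = (pcompose f ^^ i) [:0, 1:]"

lemma poly_iter_poly: "poly (iter_poly f i) x = (poly f ^^ i) x"
  by (induction i) (auto simp: iter_poly_def poly_pcompose)

lemma degree_iter_poly: "degree (iter_poly f i) = degree f ^ i"
  by (induction i) (auto simp: iter_poly_def degree_pcompose)

text \<open>The iterates of \<open>f\<close> have the pairwise different degrees \<open>1, d, d\<^sup>2, \<dots>\<close> because \<open>d > 1\<close>, so leading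
  terms cannot cancel. For linear \<open>f\<close> this fails: successive
  iterates satisfy a linear relation, and for \<open>s \<ge> 2\<close> the limit law is not uniform.\<close>
lemma degree_combination_iter_poly:
  assumes f: "degree f > 1" and h: "\<exists>i<s. h i \<noteq> (0::int)"
  shows "degree (\<Sum>i<s. smult (h i) (iter_poly f i)) > 0"
  using h
proof (induction s)
  case (Suc s)
  let ?p = "\<Sum>i<s. smult (h i) (iter_poly f i)"
  show ?case
  proof (cases "h s = 0")
    case True
    then show ?thesis
      using Suc by (auto simp: less_Suc_eq)
  next
    case False
    have d: "degree (smult (h s) (iter_poly f s)) = degree f ^ s"
      using False by (simp add: degree_iter_poly)
    have "degree (smult (h i) (iter_poly f i)) < degree f ^ s" if "i < s" for i
    proof -
      have "degree (smult (h i) (iter_poly f i)) \<le> degree f ^ i"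
        by (metis degree_smult_le degree_iter_poly)
      also have "\<dots> < degree f ^ s"
        using f that by (rule power_strict_increasing[rotated])
      finally show ?thesis .
    qed
    moreover have "0 < degree f ^ s"
      using f by simp
    ultimately have "degree ?p < degree f ^ s"
      by (intro degree_sum_less) auto
    then have "degree (?p + smult (h s) (iter_poly f s)) = degree f ^ s"
      using d by (metis degree_add_eq_right)
    then show ?thesis
      using f by simp
  qed
qed simp

section \<open>Trigonometric approximation of intervals\<close>

lemma has_integral_echar:
  "((\<lambda>t. echar (of_int k * t)) has_integral (if k = 0 then 1 else 0)) {0..1}"
proof (cases "k = 0")
  case True
  then show ?thesis
    using has_integral_const_real[of "1::complex" 0 1] by simp
next
  case False
  define w where "w = 2 * of_real pi * \<i> * of_int k"
  have w: "w \<noteq> 0"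
    using False by (simp add: w_def)
  have eq: "echar (of_int k * t) = exp (w * of_real t)" for t
    by (simp add: echar_def cis_conv_exp w_def algebra_simps)
  have "((\<lambda>t. exp (w * of_real t)) has_integral (exp (w * of_real 1) / w - exp (w * of_real 0) / w)) {0..1}"
  proof (rule fundamental_theorem_of_calculus)
    fix x :: real
    have "((\<lambda>z. exp (w * z) / w) has_field_derivative exp (w * of_real x)) (at (of_real x))"
      using w by (auto intro!: derivative_eq_intros)
    then show "((\<lambda>t. exp (w * of_real t) / w) has_vector_derivative exp (w * of_real x)) (at x within {0..1})"
      by (rule has_vector_derivative_at_within[OF has_vector_derivative_real_field])
  qed simp
  moreover have "exp (w * of_real 1) = 1"
    using eq[of 1] by simp
  ultimately show ?thesis
    using False by (simp add: eq)
qed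

inductive trig_poly :: "(real \<Rightarrow> complex) \<Rightarrow> bool" where
  monom: "trig_poly (\<lambda>t. a * echar (of_int k * t))"
| add: "trig_poly T \<Longrightarrow> trig_poly U \<Longrightarrow> trig_poly (\<lambda>t. T t + U t)"

lemma trig_poly_const: "trig_poly (\<lambda>_. a)"
  using trig_poly.monom[of a 0] by simp

lemma trig_poly_mult:
  assumes "trig_poly T" and "trig_poly U"
  shows "trig_poly (\<lambda>t. T t * U t)"
  using assms
proof (induction T rule: trig_poly.induct)
  case (monom a k)
  from monom.prems show ?case
  proof (induction U rule: trig_poly.induct)
    case (monom b l)
    have "echar (of_int (k + l) * t) = echar (of_int k * t) * echar (of_int l * t)" for t
      by (simp add: distrib_right echar_add)
    then have "(\<lambda>t. a * echar (of_int k * t) * (b * echar (of_int l * t)))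
            = (\<lambda>t. (a * b) * echar (of_int (k + l) * t))"
      by (simp only: mult_ac)
    then show ?case
      by (simp only: trig_poly.monom)
  next
    case (add T U)
    then show ?case
      unfolding distrib_left by (intro trig_poly.add)
  qed
next
  case (add T1 T2)
  then show ?case
    unfolding distrib_right by (intro trig_poly.add)
qed

lemma trig_poly_cos: "trig_poly (\<lambda>t. of_real (cos (2 * pi * t - a)))"
proof -
  have "of_real (cos (2 * pi * t - a))
          = (cis (- a) / 2) * echar (of_int 1 * t) + (cis a / 2) * echar (of_int (- 1) * t)" for t
    by (simp add: complex_eq_iff echar_def cos_diff sin_diff add_divide_distrib[symmetric])
  then show ?thesis
    by (simp only: trig_poly.intros)
qed

text \<open>Trigonometric polynomials form an algebra, so an approximation by ordinary polynomials in one
  real variable turns into one by trigonometric polynomials after substituting a cosine.\<close>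
lemma trig_poly_polynomial_comp:
  fixes p :: "real \<Rightarrow> real"
  assumes "real_polynomial_function p" and X: "trig_poly (\<lambda>t. of_real (X t))"
  shows "trig_poly (\<lambda>t. of_real (p (X t)))"
  using assms(1)
proof (induction p rule: real_polynomial_function.induct)
  case (linear p)
  have "p x = p 1 * x" for x
    using linear_scale[OF bounded_linear.linear[OF linear], of x 1] by simp
  then show ?case
    using trig_poly_mult[OF trig_poly_const X] by (metis (no_types, lifting) ext of_real_mult)
next
  case (const c)
  show ?case by (rule trig_poly_const)
next
  case (add p q)
  then show ?case
    unfolding of_real_add by (intro trig_poly.add)
next
  case (mult p q)
  then show ?case
    unfolding of_real_mult by (intro trig_poly_mult)
qed

lemma trig_poly_integrable: "trig_poly T \<Longrightarrow> T integrable_on {0..1}"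
proof (induction T rule: trig_poly.induct)
  case (monom a k)
  show ?case
    using has_integral_mult_right[OF has_integral_echar[of k], of a] by blast
qed (rule integrable_add)

text \<open>Under \<open>t \<mapsto> exp (2 \<pi> i t)\<close> the interval \<open>[0, c]\<close> becomes an arc with midpoint \<open>exp (\<pi> i c)\<close>. The arc is
  cut out by a half plane: it is where the cosine of the angle to the midpoint is at least
  \<open>cos (\<pi> c)\<close>. The factorization exhibits the sign of the difference.\<close>
lemma interval_arc_identity:
  "cos (2 * pi * t - pi * c) - cos (pi * c) = 2 * sin (pi * t) * sin (pi * (c - t))"
proof -
  have "cos (2 * pi * t - pi * c) - cos (pi * c)
          = 2 * sin ((2 * pi * t - pi * c + pi * c) / 2) * sin ((pi * c - (2 * pi * t - pi * c)) / 2)"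
    by (rule cos_diff_cos)
  also have "(2 * pi * t - pi * c + pi * c) / 2 = pi * t"
    by simp
  also have "(pi * c - (2 * pi * t - pi * c)) / 2 = pi * (c - t)"
    by (simp add: field_simps)
  finally show ?thesis .
qed

lemma interval_arc_sign:
  assumes "0 \<le> c" "c \<le> 1" "0 \<le> t" "t \<le> 1"
  shows "t \<le> c \<Longrightarrow> cos (pi * c) \<le> cos (2 * pi * t - pi * c)"
    and "c < t \<Longrightarrow> cos (2 * pi * t - pi * c) \<le> cos (pi * c)"
    and "t \<noteq> 0 \<Longrightarrow> t \<noteq> 1 \<Longrightarrow> t \<noteq> c \<Longrightarrow> cos (2 * pi * t - pi * c) \<noteq> cos (pi * c)"
proof -
  have s: "0 \<le> sin (pi * t)"
    using assms by (intro sin_ge_zero) auto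
  show "cos (pi * c) \<le> cos (2 * pi * t - pi * c)" if "t \<le> c"
  proof -
    have "pi * (c - t) \<le> pi * 1"
      using assms that by (intro mult_left_mono) auto
    then have "0 \<le> sin (pi * (c - t))"
      using that by (intro sin_ge_zero) auto
    then have "0 \<le> 2 * sin (pi * t) * sin (pi * (c - t))"
      using s by simp
    then show ?thesis
      using interval_arc_identity[of t c] by linarith
  qed
  have neg: "sin (pi * (c - t)) = - sin (pi * (t - c))"
    by (metis minus_diff_eq mult_minus_right sin_minus)
  show "cos (2 * pi * t - pi * c) \<le> cos (pi * c)" if "c < t"
  proof -
    have "pi * (t - c) \<le> pi * 1"
      using assms that by (intro mult_left_mono) auto
    then have "0 \<le> sin (pi * (t - c))"
      using that by (intro sin_ge_zero) auto
    then have "0 \<le> 2 * sin (pi * t) * sin (pi * (t - c))"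
      using s by simp
    then show ?thesis
      using interval_arc_identity[of t c] by (simp add: neg)
  qed
  show "cos (2 * pi * t - pi * c) \<noteq> cos (pi * c)" if "t \<noteq> 0" "t \<noteq> 1" "t \<noteq> c"
  proof -
    have "pi * t < pi * 1"
      using assms that by (intro mult_strict_left_mono) auto
    then have "sin (pi * t) > 0"
      using assms that by (intro sin_gt_zero) auto
    moreover have "sin (pi * (c - t)) \<noteq> 0"
    proof (cases "t < c")
      case True
      have "pi * (c - t) < pi * 1"
        using assms that True by (intro mult_strict_left_mono) auto
      then have "sin (pi * (c - t)) > 0"
        using True by (intro sin_gt_zero) auto
      then show ?thesis by simp
    next
      case False
      have "pi * (t - c) < pi * 1"
        using assms that False by (intro mult_strict_left_mono) auto
      then have "sin (pi * (t - c)) > 0"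
        using False that by (intro sin_gt_zero) auto
      then show ?thesis
        by (simp add: neg)
    qed
    ultimately show ?thesis
      using interval_arc_identity[of t c] by auto
  qed
qed

text \<open>The integrands are spikes of height \<open>1\<close> over the level set of \<open>x0\<close> whose width shrinks as \<open>k\<close>
  grows. They bound the error of replacing a jump at \<open>x0\<close> by a steep continuous ramp.\<close>
lemma integral_spikes_tendsto_0:
  fixes X :: "real \<Rightarrow> real"
  assumes cont: "continuous_on {0..1} X" and fin: "finite {t\<in>{0..1}. X t = x0}"
  shows "(\<lambda>k. integral {0..1} (\<lambda>t. max 0 (1 - real k * \<bar>X t - x0\<bar>))) \<longlonglongrightarrow> 0"
proof -
  let ?f = "\<lambda>k t. max 0 (1 - real k * \<bar>X t - x0\<bar>)"
  let ?g = "\<lambda>t. if X t = x0 then 1 else 0 :: real"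
  have "(\<lambda>k. integral {0..1} (?f k)) \<longlonglongrightarrow> integral {0..1} ?g"
  proof (rule dominated_convergence(2)[where h = "\<lambda>_. 1"])
    show "?f k integrable_on {0..1}" for k
      by (intro integrable_continuous_interval continuous_intros cont)
    show "(\<lambda>k. ?f k t) \<longlonglongrightarrow> ?g t" for t
    proof (cases "X t = x0")
      case False
      then obtain N where N: "1 < real N * \<bar>X t - x0\<bar>"
        using reals_Archimedean3[of "\<bar>X t - x0\<bar>"] by auto
      have "?f k t = 0" if "k \<ge> N" for k
      proof -
        have "real N * \<bar>X t - x0\<bar> \<le> real k * \<bar>X t - x0\<bar>"
          using that by (intro mult_right_mono) auto
        then show ?thesis
          using N by simp
      qed
      then show ?thesis
        using False by (intro tendsto_eventually) (auto simp: eventually_sequentially)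
    qed auto
  qed auto
  also have "integral {0..1} ?g = integral {0..1::real} (\<lambda>_. 0)"
    by (rule integral_spike[OF negligible_finite[OF fin]]) auto
  finally show ?thesis
    by simp
qed

text \<open>Riemann integrability of the interval in terms of trigonometric polynomials: \<open>T\<close> approximates the
  indicator, and \<open>U\<close> controls the error pointwise while having small integral.
  The indicator is a jump function of the single variable \<open>X t = cos (2 \<pi> t - \<pi> c)\<close>. It is replaced
  by a continuous ramp in \<open>X t\<close>, and the ramp and the error spike are approximated by
  polynomials in \<open>X t\<close> using Weierstrass' theorem.\<close>
lemma interval_trig_approx:
  assumes c: "0 \<le> c" "c \<le> 1" and "\<epsilon> > 0"
  obtains T U where "trig_poly T" and "trig_poly U"
    and "\<And>t. t \<in> {0..1} \<Longrightarrow> norm (of_bool (t \<le> c) - T t) \<le> Re (U t)"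
    and "Re (integral {0..1} U) \<le> \<epsilon>"
    and "norm (of_real c - integral {0..1} T) \<le> \<epsilon>"
proof -
  define X where "X t = cos (2 * pi * t - pi * c)" for t
  define x0 where "x0 = cos (pi * c)"
  \<comment> \<open>The spike contributes \<open>\<epsilon> / 2\<close> to the integral of \<open>U\<close>, the polynomial approximations \<open>3 * \<delta>\<close>.\<close>
  define \<delta> where "\<delta> = \<epsilon> / 6"
  have \<delta>: "\<delta> > 0"
    using \<open>\<epsilon> > 0\<close> by (simp add: \<delta>_def)
  have X_trig: "trig_poly (\<lambda>t. of_real (X t))"
    unfolding X_def by (rule trig_poly_cos)
  have X_cont: "continuous_on {0..1} X"
    unfolding X_def by (intro continuous_intros)
  have "{t\<in>{0..1}. X t = x0} \<subseteq> {0, 1, c}"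
    using interval_arc_sign(3)[OF c] by (auto simp: X_def x0_def)
  then have "finite {t\<in>{0..1}. X t = x0}"
    by (rule finite_subset) simp
  from LIMSEQ_D[OF integral_spikes_tendsto_0[OF X_cont this], of "\<epsilon> / 2"] \<open>\<epsilon> > 0\<close>
  obtain N where "\<And>k. k \<ge> N \<Longrightarrow>
      norm (integral {0..1} (\<lambda>t. max 0 (1 - real k * \<bar>X t - x0\<bar>)) - 0) < \<epsilon> / 2"
    by auto
  from abs_less_iff[THEN iffD1, OF this[of N, simplified real_norm_def diff_0_right, OF order.refl]]
  obtain k :: nat where k: "integral {0..1} (\<lambda>t. max 0 (1 - real k * \<bar>X t - x0\<bar>)) < \<epsilon> / 2"
    by blast
  define H where "H x = max 0 (1 - real k * \<bar>x - x0\<bar>)" for x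
  define G where "G x = (if x0 \<le> x then 1 else H x)" for x
  have G_alt: "G x = max 0 (1 - real k * max 0 (x0 - x))" for x
    by (auto simp: G_def H_def)
  have cont: "continuous_on {-1..1} H" "continuous_on {-1..1} G"
    unfolding H_def G_alt by (intro continuous_intros)+
  obtain p where p: "real_polynomial_function p" "\<And>x. x \<in> {-1..1} \<Longrightarrow> \<bar>G x - p x\<bar> < \<delta>"
    using Stone_Weierstrass_real_polynomial_function[OF compact_Icc cont(2) \<delta>] by blast
  obtain r where r: "real_polynomial_function r" "\<And>x. x \<in> {-1..1} \<Longrightarrow> \<bar>H x - r x\<bar> < \<delta>"
    using Stone_Weierstrass_real_polynomial_function[OF compact_Icc cont(1) \<delta>] by blast
  have X_range: "X t \<in> {-1..1}" for t
    by (simp add: X_def)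
  define T where "T t = complex_of_real (p (X t))" for t
  \<comment> \<open>One \<open>\<delta>\<close> pays for replacing the ramp by \<open>p\<close>, the other for replacing the spike by \<open>r\<close>.\<close>
  define U where "U t = complex_of_real (r (X t) + 2 * \<delta>)" for t
  have T: "trig_poly T"
    unfolding T_def by (rule trig_poly_polynomial_comp[OF p(1) X_trig])
  have U: "trig_poly U"
    unfolding U_def of_real_add
    by (rule trig_poly.add[OF trig_poly_polynomial_comp[OF r(1) X_trig] trig_poly_const])
  have approx: "norm (of_bool (t \<le> c) - T t) \<le> Re (U t)" if "t \<in> {0..1}" for t
  proof -
    have "\<bar>of_bool (t \<le> c) - G (X t)\<bar> \<le> H (X t)"
    proof (cases "t \<le> c")
      case True
      then have "x0 \<le> X t"
        using interval_arc_sign(1)[OF c] that by (auto simp: X_def x0_def)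
      then show ?thesis
        using True by (simp add: G_def H_def)
    next
      case False
      then have "X t \<le> x0"
        using interval_arc_sign(2)[OF c] that by (auto simp: X_def x0_def)
      then show ?thesis
        using False by (auto simp: G_def H_def)
    qed
    then have "\<bar>of_bool (t \<le> c) - p (X t)\<bar> \<le> r (X t) + 2 * \<delta>"
      using p(2)[OF X_range[of t]] r(2)[OF X_range[of t]] by linarith
    moreover have "of_bool (t \<le> c) - T t = complex_of_real (of_bool (t \<le> c) - p (X t))"
      by (simp add: T_def)
    ultimately show ?thesis
      by (simp only: norm_of_real) (simp add: U_def)
  qed
  have HX: "(\<lambda>t. H (X t)) integrable_on {0..1}"
    unfolding H_def by (intro integrable_continuous_interval continuous_intros X_cont)
  have ReU: "((\<lambda>t. Re (U t)) has_integral Re (integral {0..1} U)) {0..1}"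
    using has_integral_linear[OF integrable_integral[OF trig_poly_integrable[OF U]] bounded_linear_Re]
    by (simp add: o_def)
  have "Re (integral {0..1} U) \<le> integral {0..1} (\<lambda>t. H (X t) + 3 * \<delta>)"
  proof (rule has_integral_le[OF ReU integrable_integral])
    show "(\<lambda>t. H (X t) + 3 * \<delta>) integrable_on {0..1}"
      by (intro integrable_add HX integrable_const_ivl)
    show "Re (U t) \<le> H (X t) + 3 * \<delta>" for t
      using r(2)[OF X_range[of t]] by (simp add: U_def abs_less_iff)
  qed
  also have "\<dots> = integral {0..1} (\<lambda>t. H (X t)) + 3 * \<delta>"
    by (subst integral_add[OF HX]) auto
  also have "\<dots> \<le> \<epsilon>"
    using k by (simp add: H_def \<delta>_def)
  finally have U_small: "Re (integral {0..1} U) \<le> \<epsilon>" .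
  have ind: "((\<lambda>t. of_bool (t \<le> c) :: complex) has_integral of_real c) {0..1}"
  proof -
    have "((\<lambda>t. if t \<in> {0..c} then 1 else 0 :: complex) has_integral of_real c) {0..1}"
      using has_integral_const_real[of "1::complex" 0 c] c
      by (subst has_integral_restrict) (auto simp: scaleR_conv_of_real)
    then show ?thesis
      by (rule has_integral_eq[rotated]) auto
  qed
  have "of_real c - integral {0..1} T = integral {0..1} (\<lambda>t. of_bool (t \<le> c) - T t)"
    using has_integral_diff[OF ind integrable_integral[OF trig_poly_integrable[OF T]]]
    by (metis integral_unique)
  also have "norm \<dots> \<le> integral {0..1} (\<lambda>t. Re (U t))"
    using approx ReU
    by (intro integral_norm_bound_integral integrable_diff trig_poly_integrable[OF T]) (use ind ReU in blast)+
  also have "\<dots> \<le> \<epsilon>"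
    using U_small ReU by (metis integral_unique)
  finally show ?thesis
    using that T U approx U_small by blast
qed

section \<open>Equidistribution in the unit cube\<close>

text \<open>Weyl's criterion for finite samples in the unit cube, tested on boxes with a corner at the
  origin. Starting from products of characters, one coordinate at a time is changed from a
  character to the indicator of an interval. In the coordinate being changed the indicator is
  replaced by the trigonometric polynomial \<open>T\<close> of the previous lemma. All other factors are bounded by
  \<open>1\<close>, so the error is at most the mean of \<open>U\<close> over that single coordinate, for which the
  hypothesis gives the limit \<open>\<integral> U\<close>.\<close>
theorem weyl_criterion_boxes:
  fixes A :: "nat \<Rightarrow> 'a set" and u :: "nat \<Rightarrow> nat \<Rightarrow> 'a \<Rightarrow> real"
  assumes fin: "\<And>n. finite (A n)" and ne: "\<And>n. A n \<noteq> {}"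
    and range: "\<And>n i x. i < s \<Longrightarrow> x \<in> A n \<Longrightarrow> u n i x \<in> {0..1}"
    and weyl: "\<And>h :: nat \<Rightarrow> int. \<exists>i<s. h i \<noteq> 0 \<Longrightarrow>
      (\<lambda>n. (\<Sum>x\<in>A n. \<Prod>i<s. echar (of_int (h i) * u n i x)) / of_nat (card (A n))) \<longlonglongrightarrow> 0"
    and c: "\<And>i. i < s \<Longrightarrow> 0 \<le> c i" "\<And>i. i < s \<Longrightarrow> c i \<le> 1"
  shows "(\<lambda>n. real (card {x\<in>A n. \<forall>i<s. u n i x \<le> c i}) / real (card (A n))) \<longlonglongrightarrow> (\<Prod>i<s. c i)"
proof -
  define avg :: "nat \<Rightarrow> ('a \<Rightarrow> complex) \<Rightarrow> complex"
    where "avg n F = (\<Sum>x\<in>A n. F x) / of_nat (card (A n))" for n F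
  have card_pos: "card (A n) > 0" for n
    using fin ne by (simp add: card_gt_0_iff)
  have avg_add: "avg n (\<lambda>x. F x + G x) = avg n F + avg n G" for n F G
    by (simp add: avg_def sum.distrib add_divide_distrib)
  have avg_scale: "avg n (\<lambda>x. a * F x) = a * avg n F" for n a F
    by (simp add: avg_def sum_distrib_left)
  have avg_1: "avg n (\<lambda>_. 1) = 1" for n
    using card_pos[of n] by (simp add: avg_def)
  have avg_bound: "norm (avg n F) \<le> Re (avg n G)"
    if "\<And>x. x \<in> A n \<Longrightarrow> norm (F x) \<le> Re (G x)" for n F G
  proof -
    have "norm (\<Sum>x\<in>A n. F x) \<le> (\<Sum>x\<in>A n. Re (G x))"
      by (rule order.trans[OF norm_sum sum_mono]) (rule that)
    then show ?thesis
      using card_pos[of n] by (simp add: avg_def norm_divide divide_right_mono)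
  qed
  have chars: "(\<lambda>n. avg n (\<lambda>x. \<Prod>i<s. echar (of_int (h i) * u n i x)))
                 \<longlonglongrightarrow> (\<Prod>i<s. if h i = 0 then 1 else 0)" for h :: "nat \<Rightarrow> int"
  proof (cases "\<exists>i<s. h i \<noteq> 0")
    case True
    moreover from True have "(\<Prod>i<s. if h i = 0 then 1 else 0) = (0::complex)"
      by (intro prod_zero) auto
    ultimately show ?thesis
      using weyl[of h] by (simp only: avg_def)
  next
    case False
    then show ?thesis
      by (simp add: avg_1)
  qed
  have one_coordinate: "(\<lambda>n. avg n (\<lambda>x. U (u n j x))) \<longlonglongrightarrow> integral {0..1} U"
    if "trig_poly U" "j < s" for U j
    using that(1)
  proof (induction U rule: trig_poly.induct)
    case (monom a k)
    let ?h = "(\<lambda>_. 0)(j := k)"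
    have "(\<Prod>i<s. echar (of_int (?h i) * u n i x)) = echar (of_int k * u n j x)" for n x
    proof -
      have "(\<Prod>i<s. echar (of_int (?h i) * u n i x)) = (\<Prod>i<s. if i = j then echar (of_int k * u n j x) else 1)"
        by (intro prod.cong) auto
      then show ?thesis
        using that(2) by simp
    qed
    moreover have "(\<Prod>i<s. if ?h i = 0 then 1 else 0) = (if k = 0 then 1 else 0 :: complex)"
    proof -
      have "(\<Prod>i<s. if ?h i = 0 then 1 else 0) = (\<Prod>i<s. if i = j then (if k = 0 then 1 else 0) else 1 :: complex)"
        by (intro prod.cong) auto
      then show ?thesis
        using that(2) by simp
    qed
    ultimately have "(\<lambda>n. avg n (\<lambda>x. echar (of_int k * u n j x))) \<longlonglongrightarrow> (if k = 0 then 1 else 0)"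
      using chars[of ?h] by simp
    then have "(\<lambda>n. a * avg n (\<lambda>x. echar (of_int k * u n j x))) \<longlonglongrightarrow> a * (if k = 0 then 1 else 0)"
      by (rule tendsto_mult_left)
    then show ?case
      using integral_unique[OF has_integral_mult_right[OF has_integral_echar[of k], of a]]
      by (simp only: avg_scale)
  next
    case (add T U)
    then show ?case
      by (simp add: avg_add integral_add[OF trig_poly_integrable trig_poly_integrable] tendsto_add)
  qed
  \<comment> \<open>The first \<open>j\<close> coordinates still carry characters; the induction goes down from \<open>j = s\<close> to \<open>j = 0\<close>.\<close>
  have mixed: "\<forall>h :: nat \<Rightarrow> int.
      (\<lambda>n. avg n (\<lambda>x. (\<Prod>i<j. echar (of_int (h i) * u n i x)) * (\<Prod>i\<in>{j..<s}. of_bool (u n i x \<le> c i))))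
        \<longlonglongrightarrow> (\<Prod>i<j. if h i = 0 then 1 else 0) * (\<Prod>i\<in>{j..<s}. of_real (c i))" if "j \<le> s" for j
    using that
  proof (induction j rule: inc_induct)
    case base
    then show ?case
      using chars by simp
  next
    case (step j)
    show ?case
    proof
      fix h :: "nat \<Rightarrow> int"
      define V where "V n x = (\<Prod>i<j. echar (of_int (h i) * u n i x))
                                * (\<Prod>i\<in>{Suc j..<s}. of_bool (u n i x \<le> c i))" for n x
      define L :: complex where "L = (\<Prod>i<j. if h i = 0 then 1 else 0) * (\<Prod>i\<in>{Suc j..<s}. of_real (c i))"
      have norm_V: "norm (V n x) \<le> 1" for n x
        unfolding V_def norm_mult prod_norm[symmetric] by (intro mult_le_one prod_le_1 prod_nonneg) auto
      have norm_L: "norm L \<le> 1"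
        unfolding L_def norm_mult prod_norm[symmetric]
        using c by (intro mult_le_one prod_le_1 prod_nonneg) auto
      have trig: "(\<lambda>n. avg n (\<lambda>x. V n x * T (u n j x))) \<longlonglongrightarrow> L * integral {0..1} T"
        if "trig_poly T" for T
        using that
      proof (induction T rule: trig_poly.induct)
        case (monom a k)
        from step.IH[rule_format, of "h(j := k)"]
        have "(\<lambda>n. avg n (\<lambda>x. V n x * echar (of_int k * u n j x))) \<longlonglongrightarrow> L * (if k = 0 then 1 else 0)"
          by (simp add: V_def L_def mult_ac)
        then have "(\<lambda>n. a * avg n (\<lambda>x. V n x * echar (of_int k * u n j x)))
            \<longlonglongrightarrow> a * (L * (if k = 0 then 1 else 0))"
          by (rule tendsto_mult_left)
        moreover have "a * (L * (if k = 0 then 1 else 0)) = L * integral {0..1} (\<lambda>t. a * echar (of_int k * t))"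
          using integral_unique[OF has_integral_mult_right[OF has_integral_echar[of k], of a]]
          by (simp only: mult.left_commute)
        moreover have "a * avg n (\<lambda>x. V n x * echar (of_int k * u n j x))
            = avg n (\<lambda>x. V n x * (a * echar (of_int k * u n j x)))" for n
          by (simp add: avg_scale[symmetric] mult_ac)
        ultimately show ?case
          by simp
      next
        case (add T U)
        then show ?case
          by (simp add: distrib_left avg_add integral_add[OF trig_poly_integrable trig_poly_integrable] tendsto_add)
      qed
      have "(\<lambda>n. avg n (\<lambda>x. V n x * of_bool (u n j x \<le> c j))) \<longlonglongrightarrow> L * of_real (c j)"
      proof (rule LIMSEQ_I)
        fix e :: real
        assume "e > 0"
        then have e: "e / 4 > 0" by simp
        have cj: "0 \<le> c j" "c j \<le> 1"
          using c step.hyps by auto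
        obtain T U where T: "trig_poly T" and U: "trig_poly U"
          and TU: "\<And>t. t \<in> {0..1} \<Longrightarrow> norm (of_bool (t \<le> c j) - T t) \<le> Re (U t)"
          and IU: "Re (integral {0..1} U) \<le> e / 4"
          and IT: "norm (of_real (c j) - integral {0..1} T) \<le> e / 4"
          using interval_trig_approx[OF cj e] by blast
        obtain N1 where N1: "\<And>n. n \<ge> N1 \<Longrightarrow> norm (avg n (\<lambda>x. V n x * T (u n j x)) - L * integral {0..1} T) < e / 4"
          using LIMSEQ_D[OF trig[OF T] e] by blast
        obtain N2 where N2: "\<And>n. n \<ge> N2 \<Longrightarrow> norm (avg n (\<lambda>x. U (u n j x)) - integral {0..1} U) < e / 4"
          using LIMSEQ_D[OF one_coordinate[OF U] e] step.hyps by blast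
        show "\<exists>N. \<forall>n\<ge>N. norm (avg n (\<lambda>x. V n x * of_bool (u n j x \<le> c j)) - L * of_real (c j)) < e"
        proof (rule exI[of _ "max N1 N2"], intro allI impI)
          fix n assume "n \<ge> max N1 N2"
          then have n: "n \<ge> N1" "n \<ge> N2" by auto
          let ?D = "avg n (\<lambda>x. V n x * (of_bool (u n j x \<le> c j) - T (u n j x)))"
          have split: "avg n (\<lambda>x. V n x * of_bool (u n j x \<le> c j)) - L * of_real (c j)
              = ?D + (avg n (\<lambda>x. V n x * T (u n j x)) - L * integral {0..1} T)
                 - L * (of_real (c j) - integral {0..1} T)"
            using avg_add[of n "\<lambda>x. V n x * (of_bool (u n j x \<le> c j) - T (u n j x))" "\<lambda>x. V n x * T (u n j x)"]
            by (simp add: algebra_simps)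
          have "norm ?D \<le> Re (avg n (\<lambda>x. U (u n j x)))"
          proof (rule avg_bound)
            fix x assume "x \<in> A n"
            then have "norm (of_bool (u n j x \<le> c j) - T (u n j x)) \<le> Re (U (u n j x))"
              using step.hyps by (intro TU range)
            then show "norm (V n x * (of_bool (u n j x \<le> c j) - T (u n j x))) \<le> Re (U (u n j x))"
              unfolding norm_mult
              using mult_right_mono[OF norm_V[of n x], of "norm (of_bool (u n j x \<le> c j) - T (u n j x))"]
              by simp
          qed
          also have "\<dots> \<le> Re (integral {0..1} U) + norm (avg n (\<lambda>x. U (u n j x)) - integral {0..1} U)"
            using complex_Re_le_cmod[of "avg n (\<lambda>x. U (u n j x)) - integral {0..1} U"] by simp
          finally have D: "norm ?D < e / 2"
            using IU N2[OF n(2)] by simp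
          have "norm (L * (of_real (c j) - integral {0..1} T)) \<le> 1 * (e / 4)"
            unfolding norm_mult using norm_L IT by (intro mult_mono) auto
          then show "norm (avg n (\<lambda>x. V n x * of_bool (u n j x \<le> c j)) - L * of_real (c j)) < e"
            unfolding split using D N1[OF n(1)]
            norm_triangle_ineq[of ?D "avg n (\<lambda>x. V n x * T (u n j x)) - L * integral {0..1} T"]
            norm_triangle_ineq4[of "?D + (avg n (\<lambda>x. V n x * T (u n j x)) - L * integral {0..1} T)"
               "L * (of_real (c j) - integral {0..1} T)"]
            by linarith
        qed
      qed
      moreover have "{j..<s} = insert j {Suc j..<s}"
        using step.hyps by auto
      ultimately show "(\<lambda>n. avg n (\<lambda>x. (\<Prod>i<j. echar (of_int (h i) * u n i x)) * (\<Prod>i\<in>{j..<s}. of_bool (u n i x \<le> c i))))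
        \<longlonglongrightarrow> (\<Prod>i<j. if h i = 0 then 1 else 0) * (\<Prod>i\<in>{j..<s}. of_real (c i))"
        by (simp add: V_def L_def mult_ac)
    qed
  qed
  have "(\<lambda>n. avg n (\<lambda>x. \<Prod>i\<in>{0..<s}. of_bool (u n i x \<le> c i))) \<longlonglongrightarrow> (\<Prod>i\<in>{0..<s}. of_real (c i))"
    using mixed[of 0] by simp
  moreover have "avg n (\<lambda>x. \<Prod>i\<in>{0..<s}. of_bool (u n i x \<le> c i))
      = of_real (real (card {x\<in>A n. \<forall>i<s. u n i x \<le> c i}) / real (card (A n)))" for n
  proof -
    have "(\<Prod>i\<in>{0..<s}. of_bool (u n i x \<le> c i)) = (of_bool (\<forall>i<s. u n i x \<le> c i) :: complex)" for x
      by (cases "\<forall>i<s. u n i x \<le> c i") (auto intro!: prod_zero)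
    then have "(\<Sum>x\<in>A n. \<Prod>i\<in>{0..<s}. of_bool (u n i x \<le> c i))
        = (of_nat (card {x\<in>A n. \<forall>i<s. u n i x \<le> c i}) :: complex)"
      using fin[of n] by (simp add: of_bool_def sum.If_cases Int_def)
    then show ?thesis
      by (simp add: avg_def)
  qed
  ultimately have "(\<lambda>n. complex_of_real (real (card {x\<in>A n. \<forall>i<s. u n i x \<le> c i}) / real (card (A n))))
      \<longlonglongrightarrow> of_real (\<Prod>i<s. c i)"
    by (simp add: atLeast0LessThan)
  then show ?thesis
    by (simp only: tendsto_of_real_iff)
qed

section \<open>Distribution functions of the two laws\<close>

lemma cdf_uniform_unit_cube:
  "cdf_vec s (uniform_unit_cube s) x = (\<Prod>i<s. max 0 (min 1 (x i)))"
proof -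
  interpret product_sigma_finite "\<lambda>_::nat. lborel :: real measure" ..
  let ?M = "Pi\<^sub>M {..<s} (\<lambda>_. lborel :: real measure)"
  let ?A = "{..<s} \<rightarrow>\<^sub>E {0..<1::real}"
  let ?B = "Pi\<^sub>E {..<s} (\<lambda>i. {..x i})"
  have A: "emeasure ?M ?A = 1"
    by (subst emeasure_PiM) auto
  have B: "?B \<in> sets ?M"
    by (rule sets_PiM_I_finite) auto
  have side: "emeasure lborel ({0..<1} \<inter> {..y}) = ennreal (max 0 (min 1 y))" for y :: real
  proof -
    consider "y < 0" | "0 \<le> y" "y < 1" | "1 \<le> y" by linarith
    then show ?thesis
    proof cases
      case 1
      then have "{0..<1} \<inter> {..y} = {}" by auto
      then show ?thesis using 1 by (simp add: max_def)
    next
      case 2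
      then have "{0..<1} \<inter> {..y} = {0..y}" by auto
      then show ?thesis using 2 by simp
    next
      case 3
      then have "{0..<1} \<inter> {..y} = {0..<1}" by auto
      then show ?thesis using 3 by simp
    qed
  qed
  have "emeasure ?M (?A \<inter> ?B) = (\<Prod>i<s. emeasure lborel ({0..<1} \<inter> {..x i}))"
    unfolding PiE_Int by (subst emeasure_PiM) auto
  also have "\<dots> = ennreal (\<Prod>i<s. max 0 (min 1 (x i)))"
    unfolding side by (rule prod_ennreal) simp
  finally have AB: "measure ?M (?A \<inter> ?B) = (\<Prod>i<s. max 0 (min 1 (x i)))"
    by (simp add: measure_def prod_nonneg)
  have "{y \<in> space (uniform_unit_cube s). \<forall>i<s. y i \<le> x i} = ?B"
    by (auto simp: uniform_unit_cube_def space_PiM PiE_def Pi_def)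
  then have "cdf_vec s (uniform_unit_cube s) x = measure (uniform_measure ?M ?A) ?B"
    by (simp add: cdf_vec_def uniform_unit_cube_def)
  also have "\<dots> = measure ?M (?A \<inter> ?B) / measure ?M ?A"
    using A B by (intro measure_uniform_measure) auto
  also have "measure ?M ?A = 1"
    using A by (simp add: measure_def)
  finally show ?thesis
    using AB by simp
qed

lemma cdf_orbit_law:
  assumes "m > 0"
  shows "cdf_vec s (orbit_law m f s n) x =
     real (card {k\<in>{0..<m ^ n}. \<forall>i<s. real_of_int ((poly f ^^ i) k mod m ^ n) / real_of_int (m ^ n) \<le> x i})
       / real (card {0..<m ^ n})"
proof -
  let ?N = "Pi\<^sub>M {..<s} (\<lambda>_. borel :: real measure)"
  let ?S = "{y \<in> space ?N. \<forall>i<s. y i \<le> x i}"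
  let ?p = "pmf_of_set {0..<m ^ n}"
  have ne: "{0..<m ^ n} \<noteq> {}" "finite {0..<m ^ n}"
    using assms by auto
  have space: "orbit_vec m f s n k \<in> space ?N" for k
    by (simp add: orbit_vec_def space_PiM)
  have "?S = Pi\<^sub>E {..<s} (\<lambda>i. {..x i})"
    by (auto simp: space_PiM PiE_def Pi_def)
  moreover have "Pi\<^sub>E {..<s} (\<lambda>i. {..x i}) \<in> sets ?N"
    by (rule sets_PiM_I_finite) auto
  ultimately have S: "?S \<in> sets ?N"
    by simp
  have meas: "orbit_vec m f s n \<in> measurable (measure_pmf ?p) ?N"
    using space by (auto simp: measurable_def)
  have "cdf_vec s (orbit_law m f s n) x = measure (measure_pmf ?p) (orbit_vec m f s n -` ?S)"
    unfolding cdf_vec_def orbit_law_def space_distr by (simp add: measure_distr[OF meas S])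
  also have "\<dots> = real (card ({0..<m ^ n} \<inter> orbit_vec m f s n -` ?S)) / real (card {0..<m ^ n})"
    using ne by (rule measure_pmf_of_set)
  also have "{0..<m ^ n} \<inter> orbit_vec m f s n -` ?S
     = {k\<in>{0..<m ^ n}. \<forall>i<s. real_of_int ((poly f ^^ i) k mod m ^ n) / real_of_int (m ^ n) \<le> x i}"
    using space by (auto simp: orbit_vec_def)
  finally show ?thesis .
qed

text \<open>A character evaluated along the orbit is the exponential of a single polynomial,
  the corresponding integer combination of the iterates of \<open>f\<close>.\<close>
lemma orbit_character_mean:
  assumes "m > 0"
  shows "(\<Sum>k\<in>{0..<m ^ n}. \<Prod>i<s. echar (of_int (h i) *
            (real_of_int ((poly f ^^ i) k mod m ^ n) / real_of_int (m ^ n)))) / of_nat (card {0..<m ^ n})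
         = weyl_mean (m ^ n) (poly (\<Sum>i<s. smult (h i) (iter_poly f i)))"
proof -
  define q where "q = m ^ n"
  have q: "q > 0"
    using assms by (simp add: q_def)
  have "(\<Prod>i<s. echar (of_int (h i) * (real_of_int ((poly f ^^ i) k mod q) / real_of_int q)))
          = echar (of_int (poly (\<Sum>i<s. smult (h i) (iter_poly f i)) k) / of_int q)" for k
  proof -
    have "echar (of_int (h i) * (real_of_int ((poly f ^^ i) k mod q) / real_of_int q))
            = echar (of_int (h i * (poly f ^^ i) k) / of_int q)" for i
    proof -
      have "q dvd h i * ((poly f ^^ i) k mod q) - h i * (poly f ^^ i) k"
        unfolding right_diff_distrib[symmetric]
        by (intro dvd_mult) (metis dvd_minus_mod minus_diff_eq dvd_minus_iff)
      from echar_cong_mod[OF q this] show ?thesis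
        by simp
    qed
    then show ?thesis
      by (simp add: echar_sum[symmetric] poly_sum poly_iter_poly sum_divide_distrib del: of_int_mult)
  qed
  then show ?thesis
    using q by (simp add: weyl_mean_def q_def)
qed

theorem theorem2:
  fixes m :: int and f :: "int poly" and s :: nat
  assumes "m > 1" and "degree f > 1" and "s > 0"
  shows "weak_conv_vec s (\<lambda>n. orbit_law m f s n) (uniform_unit_cube s)"
proof -
  define u :: "nat \<Rightarrow> nat \<Rightarrow> int \<Rightarrow> real"
    where "u n i k = real_of_int ((poly f ^^ i) k mod m ^ n) / real_of_int (m ^ n)" for n i k
  have u_range: "0 \<le> u n i k" "u n i k < 1" for n i k
    using \<open>m > 1\<close> by (auto simp: u_def simp flip: of_int_power)
  have q_lim: "filterlim (\<lambda>n. m ^ n) at_top sequentially"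
  proof (rule filterlim_at_top_mono[OF filterlim_int_sequentially], rule always_eventually, rule allI)
    fix n
    have "int n \<le> 2 ^ n"
      by (metis less_exp less_imp_le of_nat_le_iff of_nat_numeral of_nat_power)
    also have "\<dots> \<le> m ^ n"
      using \<open>m > 1\<close> by (intro power_mono) auto
    finally show "int n \<le> m ^ n" .
  qed
  have weyl: "(\<lambda>n. (\<Sum>k\<in>{0..<m ^ n}. \<Prod>i<s. echar (of_int (h i) * u n i k))
                 / of_nat (card {0..<m ^ n})) \<longlonglongrightarrow> 0" if "\<exists>i<s. h i \<noteq> 0" for h :: "nat \<Rightarrow> int"
    unfolding u_def
    using weyl_mean_poly_tendsto_0[OF degree_combination_iter_poly[OF \<open>degree f > 1\<close> that] q_lim] \<open>m > 1\<close>
    by (subst orbit_character_mean) auto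
  have cdf: "cdf_vec s (orbit_law m f s n) x
      = real (card {k\<in>{0..<m ^ n}. \<forall>i<s. u n i k \<le> x i}) / real (card {0..<m ^ n})" for n x
    unfolding u_def using \<open>m > 1\<close> by (intro cdf_orbit_law) simp
  have "(\<lambda>n. cdf_vec s (orbit_law m f s n) x) \<longlonglongrightarrow> cdf_vec s (uniform_unit_cube s) x" for x
  proof (cases "\<exists>i<s. x i < 0")
    case True
    \<comment> \<open>Both distribution functions vanish outside the nonnegative orthant.\<close>
    then obtain i where i: "i < s" "x i < 0" by blast
    have "\<not> u n i k \<le> x i" for n k
      using i u_range(1)[of n i k] by linarith
    then have e: "{k\<in>{0..<m ^ n}. \<forall>i<s. u n i k \<le> x i} = {}" for n
      using i by blast
    have "cdf_vec s (orbit_law m f s n) x = 0" for n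
      by (simp only: cdf e card.empty of_nat_0 div_0)
    moreover have "cdf_vec s (uniform_unit_cube s) x = 0"
      unfolding cdf_uniform_unit_cube using i by (intro prod_zero bexI[of _ i]) auto
    ultimately show ?thesis
      by simp
  next
    case False
    then have nonneg: "\<And>i. i < s \<Longrightarrow> 0 \<le> x i"
      by (meson not_less)
    have "(\<lambda>n. real (card {k\<in>{0..<m ^ n}. \<forall>i<s. u n i k \<le> max 0 (min 1 (x i))})
            / real (card {0..<m ^ n})) \<longlonglongrightarrow> (\<Prod>i<s. max 0 (min 1 (x i)))"
      using \<open>m > 1\<close> weyl u_range by (intro weyl_criterion_boxes) (auto intro: less_imp_le)
    \<comment> \<open>Coordinates of the orbit lie in \<open>[0, 1)\<close>, so the box may be truncated to the unit cube.\<close>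
    moreover have "u n i k \<le> max 0 (min 1 (x i)) \<longleftrightarrow> u n i k \<le> x i" if "i < s" for n i k
      using nonneg[OF that] u_range(2)[of n i k] by auto
    then have "{k\<in>{0..<m ^ n}. \<forall>i<s. u n i k \<le> max 0 (min 1 (x i))}
        = {k\<in>{0..<m ^ n}. \<forall>i<s. u n i k \<le> x i}" for n
      by blast
    ultimately show ?thesis
      by (simp only: cdf cdf_uniform_unit_cube)
  qed
  then show ?thesis
    by (simp add: weak_conv_vec_def)
qed

end
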